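(* Let $T$ be a nonabelian embedding tensor on a Lie algebra $\mathfrak g$ with respect to a coherent action $(\mathfrak h;\rho)$. If two linear deformations $T^1_t=T+t\mathfrak T_1$ and $T^2_t=T+t\mathfrak T_2$ of $T$ are equivalent, then $\mathfrak T_1$ and $\mathfrak T_2$ are in the same cohomology class of $\mathcal H^2(T)$.
   Context: All vector spaces are over $\mathbb C$. A coherent action of a Lie algebra $\mathfrak g$ on a Lie algebra $\mathfrak h$, denoted $(\mathfrak h;\rho)$, is a Lie algebra homomorphism $\rho:\mathfrak g\to\mathrm{Der}(\mathfrak h)$ such that $[\rho(x)u,v]_{\mathfrak h}=0$ for all $x\in\mathfrak g$, $u,v\in\mathfrak h$. A nonabelian embedding tensor on $\mathfrak g$ with respect to $(\mathfrak h;\rho)$ is a linear map $T:\mathfrak h\to\mathfrak g$ with $[Tu,Tv]_{\mathfrak g}=T\big(\rho(Tu)(v)+[u,v]_{\mathfrak h}\big)$ for all $u,v\in\mathfrak h$. A homomorphism from a nonabelian embedding tensor $T'$ to a nonabelian embedding tensor $T$ (both on $\mathfrak g$ with respect to $(\mathfrak h;\rho)$) is a pair $(\phi_{\mathfrak g},\phi_{\mathfrak h})$ of Lie algebra homomorphisms $\phi_{\mathfrak g}:\mathfrak g\to\mathfrak g$, $\phi_{\mathfrak h}:\mathfrak h\to\mathfrak h$ with $T\circ\phi_{\mathfrak h}=\phi_{\mathfrak g}\circ T'$ and $\phi_{\mathfrak h}(\rho(x)u)=\rho(\phi_{\mathfrak g}(x))\phi_{\mathfrak h}(u)$ for all $x\in\mathfrak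 g$, $u\in\mathfrak h$. A linear map $\mathfrak T:\mathfrak h\to\mathfrak g$ generates a linear deformation $T_t=T+t\mathfrak T$ of $T$ if $T+t\mathfrak T$ is a nonabelian embedding tensor on $\mathfrak g$ with respect to $(\mathfrak h;\rho)$ for all $t\in\mathbb C$. Two linear deformations $T^1_t=T+t\mathfrak T_1$ and $T^2_t=T+t\mathfrak T_2$ are equivalent if there exists $x\in\mathfrak g$ such that, for all $t\in\mathbb C$, $(\mathrm{Id}_{\mathfrak g}+t\,\mathrm{ad}_x,\mathrm{Id}_{\mathfrak h}+t\rho(x))$ is a homomorphism from $T^2_t$ to $T^1_t$, where $\mathrm{ad}_x(y)=[x,y]_{\mathfrak g}$. Cohomology of $T$: the cochain complex has $\mathfrak C^0(T)=0$, $\mathfrak C^1(T)=\mathfrak g$, $\mathfrak C^n(T)=\mathrm{Hom}(\otimes^{n-1}\mathfrak h,\mathfrak g)$ for $n\ge2$, and coboundary $\partial_T$, given for $\theta\in\mathrm{Hom}(\otimes^k\mathfrak h,\mathfrak g)$, $k\ge0$ (with $\mathrm{Hom}(\otimes^0\mathfrak h,\mathfrak g)=\mathfrak g$), by $$\begin{aligned}\partial_T\theta(u_1,\ldots,u_{k+1})=&\sum_{i=1}^{k}(-1)^{i+1}[Tu_i,\theta(u_1,\ldots,\hat u_i,\ldots,u_{k+1})]_{\mathfrak g}+(-1)^{k+1}[\theta(u_1,\ldots,u_k),Tu_{k+1}]_{\mathfrak g}+(-1)^kT(\rho(\theta(u_1,\ldots,u_k))u_{k+1})\\&+\sum_{1\le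 i<j\le k+1}(-1)^i\theta(u_1,\ldots,\hat u_i,\ldots,u_{j-1},\rho(Tu_i)(u_j)+[u_i,u_j]_{\mathfrak h},u_{j+1},\ldots,u_{k+1}).\end{aligned}$$ In particular $(\partial_Tx)(u)=T\rho(x)u-[x,Tu]_{\mathfrak g}$ for $x\in\mathfrak g$. $\mathcal H^2(T)$ is the quotient of the space of $2$-cocycles in $\mathfrak C^2(T)=\mathrm{Hom}(\mathfrak h,\mathfrak g)$ (the kernel of $\partial_T$) by the image of $\partial_T:\mathfrak g\to\mathrm{Hom}(\mathfrak h,\mathfrak g)$. If $\mathfrak T$ generates a linear deformation of $T$, then $\partial_T\mathfrak T=0$. *)

theory Defs
  imports Complex_Main
begin

class complex_lie_algebra = ab_group_add +
  fixes scaleC :: "complex \<Rightarrow> 'a \<Rightarrow> 'a"  (infixr "*\<^sub>C" 75)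
    and lie_bracket :: "'a \<Rightarrow> 'a \<Rightarrow> 'a"  ("[_, _]\<^sub>L")
  assumes scaleC_add_right: "a *\<^sub>C (x + y) = a *\<^sub>C x + a *\<^sub>C y"
    and scaleC_add_left: "(a + b) *\<^sub>C x = a *\<^sub>C x + b *\<^sub>C x"
    and scaleC_scaleC: "a *\<^sub>C b *\<^sub>C x = (a * b) *\<^sub>C x"
    and scaleC_one: "1 *\<^sub>C x = x"
    and lie_add_left: "[x + y, z]\<^sub>L = [x, z]\<^sub>L + [y, z]\<^sub>L"
    and lie_scale_left: "[a *\<^sub>C x, z]\<^sub>L = a *\<^sub>C [x, z]\<^sub>L"
    and lie_add_right: "[x, y + z]\<^sub>L = [x, y]\<^sub>L + [x, z]\<^sub>L"
    and lie_scale_right: "[x, a *\<^sub>C z]\<^sub>L = a *\<^sub>C [x, z]\<^sub>L"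
    and lie_self: "[x, x]\<^sub>L = 0"
    and jacobi: "[x, [y, z]\<^sub>L]\<^sub>L + [y, [z, x]\<^sub>L]\<^sub>L + [z, [x, y]\<^sub>L]\<^sub>L = 0"

lemma vector_space_scaleC:
  "vector_space (scaleC :: complex \<Rightarrow> 'a \<Rightarrow> 'a::complex_lie_algebra)"
  by unfold_locales
    (simp_all add: scaleC_add_right scaleC_add_left scaleC_scaleC scaleC_one)

abbreviation clinear :: "('a::complex_lie_algebra \<Rightarrow> 'b::complex_lie_algebra) \<Rightarrow> bool" where
  "clinear \<equiv> Vector_Spaces.linear scaleC scaleC"

definition lie_hom :: "('a::complex_lie_algebra \<Rightarrow> 'b::complex_lie_algebra) \<Rightarrow> bool" where
  "lie_hom f \<longleftrightarrow> clinear f \<and> (\<forall>x y. f [x, y]\<^sub>L = [f x, f y]\<^sub>L)"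

definition derivation :: "('h::complex_lie_algebra \<Rightarrow> 'h) \<Rightarrow> bool" where
  "derivation d \<longleftrightarrow> clinear d \<and> (\<forall>u v. d [u, v]\<^sub>L = [d u, v]\<^sub>L + [u, d v]\<^sub>L)"

text \<open>The second and third conjuncts say that \<open>\<rho>\<close> is a Lie algebra homomorphism into the
  derivations of \<open>'h\<close>, whose bracket is the commutator.\<close>

definition coherent_action ::
    "('g::complex_lie_algebra \<Rightarrow> 'h::complex_lie_algebra \<Rightarrow> 'h) \<Rightarrow> bool" where
  "coherent_action \<rho> \<longleftrightarrow>
     (\<forall>x. derivation (\<rho> x)) \<and>
     (\<forall>u. clinear (\<lambda>x. \<rho> x u)) \<and>
     (\<forall>x y u. \<rho> [x, y]\<^sub>L u = \<rho> x (\<rho> y u) - \<rho> y (\<rho> x u)) \<and>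
     (\<forall>x u v. [\<rho> x u, v]\<^sub>L = 0)"

definition embedding_tensor ::
    "('g::complex_lie_algebra \<Rightarrow> 'h::complex_lie_algebra \<Rightarrow> 'h) \<Rightarrow> ('h \<Rightarrow> 'g) \<Rightarrow> bool" where
  "embedding_tensor \<rho> T \<longleftrightarrow>
     clinear T \<and> (\<forall>u v. [T u, T v]\<^sub>L = T (\<rho> (T u) v + [u, v]\<^sub>L))"

text \<open>\<open>embedding_tensor_hom \<rho> T' T \<phi> \<psi>\<close>: the pair \<open>(\<phi>, \<psi>)\<close> is a homomorphism
  from \<open>T'\<close> to \<open>T\<close>.\<close>

definition embedding_tensor_hom ::
    "('g::complex_lie_algebra \<Rightarrow> 'h::complex_lie_algebra \<Rightarrow> 'h) \<Rightarrow> ('h \<Rightarrow> 'g) \<Rightarrow> ('h \<Rightarrow> 'g) \<Rightarrow>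
     ('g \<Rightarrow> 'g) \<Rightarrow> ('h \<Rightarrow> 'h) \<Rightarrow> bool" where
  "embedding_tensor_hom \<rho> T' T \<phi> \<psi> \<longleftrightarrow>
     lie_hom \<phi> \<and> lie_hom \<psi> \<and> T \<circ> \<psi> = \<phi> \<circ> T' \<and>
     (\<forall>x u. \<psi> (\<rho> x u) = \<rho> (\<phi> x) (\<psi> u))"

definition deform ::
    "('h \<Rightarrow> 'g::complex_lie_algebra) \<Rightarrow> ('h \<Rightarrow> 'g) \<Rightarrow> complex \<Rightarrow> 'h \<Rightarrow> 'g" where
  "deform T D t = (\<lambda>u. T u + t *\<^sub>C D u)"

definition generates_linear_deformation ::
    "('g::complex_lie_algebra \<Rightarrow> 'h::complex_lie_algebra \<Rightarrow> 'h) \<Rightarrow> ('h \<Rightarrow> 'g) \<Rightarrow> ('h \<Rightarrow> 'g) \<Rightarrow> bool"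
  where
  "generates_linear_deformation \<rho> T D \<longleftrightarrow>
     clinear D \<and> (\<forall>t. embedding_tensor \<rho> (deform T D t))"

definition equivalent_deformations ::
    "('g::complex_lie_algebra \<Rightarrow> 'h::complex_lie_algebra \<Rightarrow> 'h) \<Rightarrow> ('h \<Rightarrow> 'g) \<Rightarrow>
     ('h \<Rightarrow> 'g) \<Rightarrow> ('h \<Rightarrow> 'g) \<Rightarrow> bool" where
  "equivalent_deformations \<rho> T D\<^sub>1 D\<^sub>2 \<longleftrightarrow>
     (\<exists>x. \<forall>t. embedding_tensor_hom \<rho> (deform T D\<^sub>2 t) (deform T D\<^sub>1 t)
                (\<lambda>y. y + t *\<^sub>C [x, y]\<^sub>L) (\<lambda>u. u + t *\<^sub>C \<rho> x u))"

text \<open>A linear map from the \<open>k\<close>-fold tensor power of \<open>'h\<close> to \<open>'g\<close> is represented by the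
  corresponding \<open>k\<close>-linear map on lists of length \<open>k\<close>, extended by \<open>0\<close> to all other lists so that
  distinct functions are distinct cochains. Cochains of degree \<open>n \<ge> 1\<close> have \<open>n - 1\<close> arguments.\<close>

definition multilinear_maps ::
    "nat \<Rightarrow> ('h::complex_lie_algebra list \<Rightarrow> 'g::complex_lie_algebra) set" where
  "multilinear_maps k = {\<theta>.
     (\<forall>us i. length us = k \<and> i < k \<longrightarrow> clinear (\<lambda>v. \<theta> (us[i := v]))) \<and>
     (\<forall>us. length us \<noteq> k \<longrightarrow> \<theta> us = 0)}"

fun cochains ::
    "nat \<Rightarrow> ('h::complex_lie_algebra list \<Rightarrow> 'g::complex_lie_algebra) set" where
  "cochains 0 = {\<lambda>_. 0}"
| "cochains (Suc k) = multilinear_maps k"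

definition linear_cochain :: "('h \<Rightarrow> 'g::complex_lie_algebra) \<Rightarrow> 'h list \<Rightarrow> 'g" where
  "linear_cochain f us = (if length us = 1 then f (hd us) else 0)"

text \<open>Removal of the \<open>i\<close>-th entry, counting from 1.\<close>

definition omit :: "nat \<Rightarrow> 'a list \<Rightarrow> 'a list" where
  "omit i us = take (i - 1) us @ drop i us"

text \<open>The coboundary of a map with \<open>k\<close> arguments. Below \<open>u i = us ! (i - 1)\<close>, so that indices
  run from 1 to \<open>k + 1\<close>.\<close>

definition coboundary_map ::
    "('g::complex_lie_algebra \<Rightarrow> 'h::complex_lie_algebra \<Rightarrow> 'h) \<Rightarrow> ('h \<Rightarrow> 'g) \<Rightarrow> nat \<Rightarrow>
     ('h list \<Rightarrow> 'g) \<Rightarrow> 'h list \<Rightarrow> 'g" where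
  "coboundary_map \<rho> T k \<theta> us =
     (if length us \<noteq> k + 1 then 0 else
      let u = (\<lambda>i. us ! (i - 1)) in
        (\<Sum>i=1..k. (-1) ^ (i + 1) *\<^sub>C [T (u i), \<theta> (omit i us)]\<^sub>L)
      + (-1) ^ (k + 1) *\<^sub>C [\<theta> (take k us), T (u (k + 1))]\<^sub>L
      + (-1) ^ k *\<^sub>C T (\<rho> (\<theta> (take k us)) (u (k + 1)))
      + (\<Sum>i=1..k. \<Sum>j=i+1..k+1. (-1) ^ i *\<^sub>C
           \<theta> (omit i (us[j - 1 := \<rho> (T (u i)) (u j) + [u i, u j]\<^sub>L]))))"

fun coboundary ::
    "('g::complex_lie_algebra \<Rightarrow> 'h::complex_lie_algebra \<Rightarrow> 'h) \<Rightarrow> ('h \<Rightarrow> 'g) \<Rightarrow> nat \<Rightarrow>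
     ('h list \<Rightarrow> 'g) \<Rightarrow> 'h list \<Rightarrow> 'g" where
  "coboundary \<rho> T 0 \<theta> = (\<lambda>_. 0)"
| "coboundary \<rho> T (Suc k) \<theta> = coboundary_map \<rho> T k \<theta>"

lemma coboundary_degree_1:
  fixes \<rho> :: "'g::complex_lie_algebra \<Rightarrow> 'h::complex_lie_algebra \<Rightarrow> 'h"
  shows "coboundary \<rho> T 1 \<theta> [u] = T (\<rho> (\<theta> []) u) - [\<theta> [], T u]\<^sub>L"
proof -
  interpret vector_space "scaleC :: complex \<Rightarrow> 'g \<Rightarrow> 'g" by (rule vector_space_scaleC)
  show ?thesis by (simp add: coboundary_map_def)
qed

lemma coboundary_degree_2:
  fixes \<rho> :: "'g::complex_lie_algebra \<Rightarrow> 'h::complex_lie_algebra \<Rightarrow> 'h"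
  shows "coboundary \<rho> T 2 (linear_cochain f) [u, v] =
    [T u, f v]\<^sub>L + [f u, T v]\<^sub>L - T (\<rho> (f u) v) - f (\<rho> (T u) v + [u, v]\<^sub>L)"
proof -
  interpret vector_space "scaleC :: complex \<Rightarrow> 'g \<Rightarrow> 'g" by (rule vector_space_scaleC)
  show ?thesis
    by (simp add: numeral_2_eq_2 coboundary_map_def linear_cochain_def omit_def)
qed

definition cocycles ::
    "('g::complex_lie_algebra \<Rightarrow> 'h::complex_lie_algebra \<Rightarrow> 'h) \<Rightarrow> ('h \<Rightarrow> 'g) \<Rightarrow> nat \<Rightarrow>
     ('h list \<Rightarrow> 'g) set" where
  "cocycles \<rho> T n = {\<theta> \<in> cochains n. coboundary \<rho> T n \<theta> = (\<lambda>_. 0)}"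

fun coboundaries ::
    "('g::complex_lie_algebra \<Rightarrow> 'h::complex_lie_algebra \<Rightarrow> 'h) \<Rightarrow> ('h \<Rightarrow> 'g) \<Rightarrow> nat \<Rightarrow>
     ('h list \<Rightarrow> 'g) set" where
  "coboundaries \<rho> T 0 = {\<lambda>_. 0}"
| "coboundaries \<rho> T (Suc n) = coboundary \<rho> T n ` cochains n"

text \<open>The elements of \<open>cohomology \<rho> T n\<close> are the cohomology classes, as sets of cocycles.\<close>

definition cohomology ::
    "('g::complex_lie_algebra \<Rightarrow> 'h::complex_lie_algebra \<Rightarrow> 'h) \<Rightarrow> ('h \<Rightarrow> 'g) \<Rightarrow> nat \<Rightarrow>
     ('h list \<Rightarrow> 'g) set set" where
  "cohomology \<rho> T n =
     cocycles \<rho> T n // {(\<theta>, \<eta>). \<theta> \<in> cocycles \<rho> T n \<and> \<eta> \<in> cocycles \<rho> T n \<and>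
                                  (\<lambda>us. \<theta> us - \<eta> us) \<in> coboundaries \<rho> T n}"

end

theory Submission
  imports Defs
begin

text \<open>
  Compatibility of the pair \<open>(Id + t ad\<^sub>x, Id + t \<rho>(x))\<close> with the two deformations reads
  \<open>(T + t D\<^sub>1) (u + t \<rho>(x) u) = T u + t D\<^sub>2 u + t [x, T u + t D\<^sub>2 u]\<close>,
  an identity between polynomials in \<open>t\<close> with coefficients in the Lie algebra. Their linear
  coefficients agree, that is, \<open>D\<^sub>1 u + T (\<rho> x u) = D\<^sub>2 u + [x, T u]\<close>, so \<open>D\<^sub>2 - D\<^sub>1\<close> is the
  coboundary of \<open>x\<close>. In the same way, the cocycle condition on a generator of a linear deformation
  is the linear coefficient of the embedding tensor identity for \<open>T + t D\<close>. Thus both facts come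
  from comparing coefficients (\<open>linear_coefficients_eq\<close>); what remains is to identify elements of
  the Lie algebra and linear maps with cochains of degrees 1 and 2.
\<close>

lemma scaleC_minus_one: "(- 1) *\<^sub>C a = - (a::'a::complex_lie_algebra)"
proof -
  interpret vector_space "scaleC :: complex \<Rightarrow> 'a \<Rightarrow> 'a" by (rule vector_space_scaleC)
  show ?thesis by simp
qed

text \<open>The difference of a polynomial's values at \<open>1\<close> and \<open>- 1\<close> is twice its linear coefficient, because the
  even part cancels; so two parameter values determine that coefficient.\<close>

lemma linear_coefficients_eq:
  fixes a b c a' b' c' :: "'a::complex_lie_algebra"
  assumes "\<And>t. a + t *\<^sub>C b + (t * t) *\<^sub>C c = a' + t *\<^sub>C b' + (t * t) *\<^sub>C c'"
  shows "b = b'"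
proof -
  have "a + b + c = a' + b' + c'"
    using assms[of 1] by (simp add: scaleC_one)
  moreover have "a - b + c = a' - b' + c'"
    using assms[of "- 1"] by (simp add: scaleC_one scaleC_minus_one)
  ultimately have "(a + b + c) - (a - b + c) = (a' + b' + c') - (a' - b' + c')"
    by simp
  then have "b + b = b' + b'"
    by (simp add: algebra_simps)
  moreover have "2 *\<^sub>C y = y + y" for y :: 'a
    using scaleC_add_left[of 1 1 y] by (simp add: scaleC_one)
  ultimately have "(1/2) *\<^sub>C 2 *\<^sub>C b = (1/2) *\<^sub>C 2 *\<^sub>C b'"
    by simp
  then show ?thesis
    by (simp add: scaleC_scaleC scaleC_one)
qed

lemma clinear_add: "clinear f \<Longrightarrow> f (x + y) = f x + f y"
  unfolding linear_iff_module_hom by (rule module_hom.add)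

lemma clinear_scaleC: "clinear f \<Longrightarrow> f (t *\<^sub>C x) = t *\<^sub>C f x"
  unfolding linear_iff_module_hom by (rule module_hom.scale)

text \<open>A map without arguments is an element of the Lie algebra; as a cochain of degree 1 it is
  supported on the empty list, which stands for the unit of the tensor algebra.\<close>

definition constant_cochain :: "'g::complex_lie_algebra \<Rightarrow> 'h list \<Rightarrow> 'g" where
  "constant_cochain x us = (if us = [] then x else 0)"

lemma constant_cochain_in_cochains: "constant_cochain x \<in> cochains 1"
  by (simp add: multilinear_maps_def constant_cochain_def)

lemma linear_cochain_in_cochains:
  assumes "clinear f"
  shows "linear_cochain f \<in> cochains 2"
proof -
  have "(\<lambda>v. linear_cochain f (us[i := v])) = f" if "length us = 1" "i < 1" for us i
    using that by (auto simp: linear_cochain_def length_Suc_conv)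
  with assms show ?thesis
    by (auto simp: numeral_2_eq_2 multilinear_maps_def linear_cochain_def)
qed

lemma coboundary_constant_cochain:
  "coboundary \<rho> T 1 (constant_cochain x) = linear_cochain (\<lambda>u. T (\<rho> x u) - [x, T u]\<^sub>L)"
proof
  fix us
  show "coboundary \<rho> T 1 (constant_cochain x) us =
      linear_cochain (\<lambda>u. T (\<rho> x u) - [x, T u]\<^sub>L) us"
  proof (cases "length us = 1")
    case True
    then obtain u where "us = [u]"
      by (auto simp: length_Suc_conv)
    then show ?thesis
      using coboundary_degree_1[of \<rho> T "constant_cochain x" u]
      by (simp add: constant_cochain_def linear_cochain_def)
  next
    case False
    then show ?thesis
      by (simp add: coboundary_map_def linear_cochain_def)
  qed
qed

lemma linear_cochain_in_coboundaries:
  assumes "\<And>u. f u = T (\<rho> x u) - [x, T u]\<^sub>L"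
  shows "linear_cochain f \<in> coboundaries \<rho> T 2"
proof -
  have "f = (\<lambda>u. T (\<rho> x u) - [x, T u]\<^sub>L)"
    using assms by blast
  then have "linear_cochain f = coboundary \<rho> T 1 (constant_cochain x)"
    by (simp only: coboundary_constant_cochain)
  then have "linear_cochain f \<in> coboundary \<rho> T 1 ` cochains 1"
    using constant_cochain_in_cochains by (rule image_eqI)
  then show ?thesis
    by (simp only: numeral_2_eq_2 One_nat_def coboundaries.simps)
qed

lemma linear_cochain_in_cocycles:
  assumes "clinear f"
    and "\<And>u v. [T u, f v]\<^sub>L + [f u, T v]\<^sub>L = T (\<rho> (f u) v) + f (\<rho> (T u) v + [u, v]\<^sub>L)"
  shows "linear_cochain f \<in> cocycles \<rho> T 2"
proof -
  have "coboundary \<rho> T 2 (linear_cochain f) us = 0" for us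
  proof (cases "length us = 2")
    case True
    then obtain u v where "us = [u, v]"
      by (auto simp: numeral_2_eq_2 length_Suc_conv)
    then show ?thesis
      using assms(2)[of u v] by (simp add: coboundary_degree_2)
  next
    case False
    then show ?thesis
      by (simp add: numeral_2_eq_2 coboundary_map_def)
  qed
  with linear_cochain_in_cochains[OF assms(1)] show ?thesis
    by (auto simp: cocycles_def)
qed

lemma linear_deformation_generator_cocycle:
  fixes \<rho> :: "'g::complex_lie_algebra \<Rightarrow> 'h::complex_lie_algebra \<Rightarrow> 'h"
  assumes rho: "\<And>u. clinear (\<lambda>x. \<rho> x u)"
    and T: "clinear T"
    and D: "generates_linear_deformation \<rho> T D"
  shows "linear_cochain D \<in> cocycles \<rho> T 2"
proof (rule linear_cochain_in_cocycles)
  show lin: "clinear D"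
    using D by (simp add: generates_linear_deformation_def)
  fix u v
  let ?w = "\<rho> (T u) v + [u, v]\<^sub>L"
  show "[T u, D v]\<^sub>L + [D u, T v]\<^sub>L = T (\<rho> (D u) v) + D ?w"
  proof (rule linear_coefficients_eq)
    fix t
    have "[deform T D t u, deform T D t v]\<^sub>L =
        deform T D t (\<rho> (deform T D t u) v + [u, v]\<^sub>L)"
      using D by (auto simp: generates_linear_deformation_def embedding_tensor_def)
    moreover have "[deform T D t u, deform T D t v]\<^sub>L =
        [T u, T v]\<^sub>L + t *\<^sub>C ([T u, D v]\<^sub>L + [D u, T v]\<^sub>L) + (t * t) *\<^sub>C [D u, D v]\<^sub>L"
      by (simp add: deform_def lie_add_left lie_add_right lie_scale_left lie_scale_right
          scaleC_add_right scaleC_scaleC add_ac)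
    moreover have "\<rho> (deform T D t u) v + [u, v]\<^sub>L = ?w + t *\<^sub>C \<rho> (D u) v"
      using clinear_add[OF rho] clinear_scaleC[OF rho] by (simp add: deform_def add_ac)
    moreover have "deform T D t (?w + t *\<^sub>C \<rho> (D u) v) =
        T ?w + t *\<^sub>C (T (\<rho> (D u) v) + D ?w) + (t * t) *\<^sub>C D (\<rho> (D u) v)"
      by (simp add: deform_def clinear_add[OF T] clinear_add[OF lin] clinear_scaleC[OF T]
          clinear_scaleC[OF lin] scaleC_add_right scaleC_scaleC add_ac)
    ultimately show "[T u, T v]\<^sub>L + t *\<^sub>C ([T u, D v]\<^sub>L + [D u, T v]\<^sub>L) + (t * t) *\<^sub>C [D u, D v]\<^sub>L =
        T ?w + t *\<^sub>C (T (\<rho> (D u) v) + D ?w) + (t * t) *\<^sub>C D (\<rho> (D u) v)"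
      by simp
  qed
qed

text \<open>The equivalence goes from the deformation by \<open>D\<^sub>2\<close> to the one by \<open>D\<^sub>1\<close>, so \<open>ad\<^sub>x\<close> acts on the side of
  \<open>D\<^sub>2\<close> and \<open>\<rho>(x)\<close> on the side of \<open>D\<^sub>1\<close>; this fixes the sign of the coboundary.\<close>

lemma equivalent_deformations_difference:
  assumes T: "clinear T" and D\<^sub>1: "clinear D\<^sub>1"
    and "equivalent_deformations \<rho> T D\<^sub>1 D\<^sub>2"
  obtains x where "\<And>u. D\<^sub>2 u - D\<^sub>1 u = T (\<rho> x u) - [x, T u]\<^sub>L"
proof -
  obtain x where hom: "\<And>t. embedding_tensor_hom \<rho> (deform T D\<^sub>2 t) (deform T D\<^sub>1 t)
      (\<lambda>y. y + t *\<^sub>C [x, y]\<^sub>L) (\<lambda>u. u + t *\<^sub>C \<rho> x u)"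
    using assms(3) by (auto simp: equivalent_deformations_def)
  have "T (\<rho> x u) + D\<^sub>1 u = D\<^sub>2 u + [x, T u]\<^sub>L" for u
  proof (rule linear_coefficients_eq)
    fix t
    have "deform T D\<^sub>1 t (u + t *\<^sub>C \<rho> x u) = deform T D\<^sub>2 t u + t *\<^sub>C [x, deform T D\<^sub>2 t u]\<^sub>L"
      using hom[of t] by (simp add: embedding_tensor_hom_def fun_eq_iff)
    moreover have "deform T D\<^sub>1 t (u + t *\<^sub>C \<rho> x u) =
        T u + t *\<^sub>C (T (\<rho> x u) + D\<^sub>1 u) + (t * t) *\<^sub>C D\<^sub>1 (\<rho> x u)"
      by (simp add: deform_def clinear_add[OF T] clinear_add[OF D\<^sub>1] clinear_scaleC[OF T]
          clinear_scaleC[OF D\<^sub>1] scaleC_add_right scaleC_scaleC add_ac)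
    moreover have "deform T D\<^sub>2 t u + t *\<^sub>C [x, deform T D\<^sub>2 t u]\<^sub>L =
        T u + t *\<^sub>C (D\<^sub>2 u + [x, T u]\<^sub>L) + (t * t) *\<^sub>C [x, D\<^sub>2 u]\<^sub>L"
      by (simp add: deform_def lie_add_right lie_scale_right scaleC_add_right scaleC_scaleC add_ac)
    ultimately show "T u + t *\<^sub>C (T (\<rho> x u) + D\<^sub>1 u) + (t * t) *\<^sub>C D\<^sub>1 (\<rho> x u) =
        T u + t *\<^sub>C (D\<^sub>2 u + [x, T u]\<^sub>L) + (t * t) *\<^sub>C [x, D\<^sub>2 u]\<^sub>L"
      by simp
  qed
  then have "D\<^sub>2 u - D\<^sub>1 u = T (\<rho> x u) - [x, T u]\<^sub>L" for u
    by (metis add_diff_cancel_left' add_diff_eq diff_add_eq diff_eq_eq)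
  then show ?thesis
    by (rule that)
qed

theorem theorem6p4:
  fixes \<rho> :: "'g::complex_lie_algebra \<Rightarrow> 'h::complex_lie_algebra \<Rightarrow> 'h"
    and T D\<^sub>1 D\<^sub>2 :: "'h \<Rightarrow> 'g"
  assumes "coherent_action \<rho>"
    and "embedding_tensor \<rho> T"
    and "generates_linear_deformation \<rho> T D\<^sub>1"
    and "generates_linear_deformation \<rho> T D\<^sub>2"
    and "equivalent_deformations \<rho> T D\<^sub>1 D\<^sub>2"
  shows "\<exists>C \<in> cohomology \<rho> T 2. linear_cochain D\<^sub>1 \<in> C \<and> linear_cochain D\<^sub>2 \<in> C"
proof -
  have rho: "clinear (\<lambda>x. \<rho> x u)" for u
    using assms(1) by (simp add: coherent_action_def)
  have T: "clinear T"
    using assms(2) by (simp add: embedding_tensor_def)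
  have D\<^sub>1: "clinear D\<^sub>1"
    using assms(3) by (simp add: generates_linear_deformation_def)
  have cocycles: "linear_cochain D\<^sub>1 \<in> cocycles \<rho> T 2" "linear_cochain D\<^sub>2 \<in> cocycles \<rho> T 2"
    using linear_deformation_generator_cocycle[of \<rho> T, OF rho T] assms(3,4) by blast+
  obtain x where x: "\<And>u. D\<^sub>2 u - D\<^sub>1 u = T (\<rho> x u) - [x, T u]\<^sub>L"
    using equivalent_deformations_difference[OF T D\<^sub>1 assms(5)] by blast
  have diff: "(\<lambda>us. linear_cochain f us - linear_cochain g us) = linear_cochain (\<lambda>u. f u - g u)"
    for f g :: "'h \<Rightarrow> 'g"
    by (auto simp: linear_cochain_def)
  \<comment> \<open>The common class is that of \<open>D\<^sub>2\<close>, so that the coboundary of \<open>x\<close>, without a change of sign,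
    relates it to \<open>D\<^sub>1\<close>. It contains \<open>D\<^sub>2\<close> itself because \<open>0\<close> is the coboundary of \<open>0\<close>.\<close>
  define R where "R = {(\<theta>, \<eta>). \<theta> \<in> cocycles \<rho> T 2 \<and> \<eta> \<in> cocycles \<rho> T 2 \<and>
      (\<lambda>us. \<theta> us - \<eta> us) \<in> coboundaries \<rho> T 2}"
  have "(\<lambda>us. linear_cochain D\<^sub>2 us - linear_cochain D\<^sub>1 us) \<in> coboundaries \<rho> T 2"
    unfolding diff using x by (rule linear_cochain_in_coboundaries)
  moreover have "(\<lambda>us. linear_cochain D\<^sub>2 us - linear_cochain D\<^sub>2 us) \<in> coboundaries \<rho> T 2"
    unfolding diff
  proof (rule linear_cochain_in_coboundaries)
    fix u
    have "\<rho> 0 u = 0" "T 0 = 0" "[0, T u]\<^sub>L = 0"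
      using clinear_add[OF rho, of 0 0 u] clinear_add[OF T, of 0 0] lie_add_left[of 0 0 "T u"]
      by simp_all
    then show "D\<^sub>2 u - D\<^sub>2 u = T (\<rho> 0 u) - [0, T u]\<^sub>L"
      by simp
  qed
  ultimately have "linear_cochain D\<^sub>1 \<in> R `` {linear_cochain D\<^sub>2}"
    "linear_cochain D\<^sub>2 \<in> R `` {linear_cochain D\<^sub>2}"
    using cocycles by (auto simp: R_def)
  moreover have "R `` {linear_cochain D\<^sub>2} \<in> cohomology \<rho> T 2"
    unfolding cohomology_def R_def using cocycles(2) by (rule quotientI)
  ultimately show ?thesis
    by blast
qed

end
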